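(* Let $(\mathfrak g,\{J_1,J_2,J_3\})$ be a $2$-step nilpotent hypercomplex Lie algebra. Then $(\mathfrak g,\{J_\alpha\})$ is $\mathbb H$-solvable. In particular, $\mathfrak g_1^{\mathbb H}=\mathfrak g^1+J_1\mathfrak g^1+J_2\mathfrak g^1+J_3\mathfrak g^1$ is a proper ideal of $\mathfrak g$, and the $\mathbb H$-solvability step is at most $3$.
   Context: Lie algebras are real and finite-dimensional. A hypercomplex Lie algebra $(\mathfrak g,\{J_\alpha\})$ is a Lie algebra $\mathfrak g$ with linear endomorphisms $J_1,J_2,J_3$ such that $J_\alpha^2=-I$, $J_1J_2=-J_2J_1=J_3$, and $[X,Y]+J_\alpha([J_\alpha X,Y]+[X,J_\alpha Y])-[J_\alpha X,J_\alpha Y]=0$ for all $X,Y\in\mathfrak g$, $\alpha=1,2,3$. Put $\mathfrak g^1=[\mathfrak g,\mathfrak g]$; $\mathfrak g$ is $2$-step nilpotent if $\mathfrak g^1$ is nonzero and contained in the center of $\mathfrak g$. For a subspace $W\subset\mathfrak g$ let $\mathbb HW=W+J_1W+J_2W+J_3W$. Define inductively $\mathfrak g_0^{\mathbb H}=\mathfrak g$ and $\mathfrak g_k^{\mathbb H}=\mathbb H[\mathfrak g_{k-1}^{\mathbb H},\mathfrak g_{k-1}^{\mathbb H}]$ for $k\ge1$. The hypercomplex Lie algebra is $\mathbb H$-solvable if $\mathfrak g_k^{\mathbb H}=0$ for some $k\in\mathbb N$; the smallest such $k$ is the $\mathbb H$-solvability step. *)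

theory Defs
  imports "HOL-Analysis.Analysis" "HOL-Library.Set_Algebras"
begin

text \<open>The underlying vector space is a whole type; finite dimension is an explicit assumption.\<close>

locale real_lie_algebra =
  fixes br :: "'a::real_vector \<Rightarrow> 'a \<Rightarrow> 'a"
  assumes finite_dim: "\<exists>B :: 'a set. finite B \<and> span B = UNIV"
    and br_bilinear: "bilinear br"
    and br_alternating: "br X X = 0"
    and br_jacobi: "br X (br Y Z) + br Y (br Z X) + br Z (br X Y) = 0"

definition nijenhuis :: "('a::real_vector \<Rightarrow> 'a \<Rightarrow> 'a) \<Rightarrow> ('a \<Rightarrow> 'a) \<Rightarrow> 'a \<Rightarrow> 'a \<Rightarrow> 'a" where
  "nijenhuis br J X Y = br X Y + J (br (J X) Y + br X (J Y)) - br (J X) (J Y)"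

locale hypercomplex_lie_algebra = real_lie_algebra br
  for br :: "'a::real_vector \<Rightarrow> 'a \<Rightarrow> 'a" +
  fixes J1 J2 J3 :: "'a \<Rightarrow> 'a"
  assumes J_linear: "linear J1" "linear J2" "linear J3"
    and J_square: "J1 (J1 X) = - X" "J2 (J2 X) = - X" "J3 (J3 X) = - X"
    and J1_J2: "J1 (J2 X) = J3 X"
    and J2_J1: "- J2 (J1 X) = J3 X"
    and J_integrable:
      "nijenhuis br J1 X Y = 0" "nijenhuis br J2 X Y = 0" "nijenhuis br J3 X Y = 0"

definition bracket_space :: "('a::real_vector \<Rightarrow> 'a \<Rightarrow> 'a) \<Rightarrow> 'a set \<Rightarrow> 'a set \<Rightarrow> 'a set" where
  "bracket_space br V W = span {br X Y | X Y. X \<in> V \<and> Y \<in> W}"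

definition lie_derived :: "('a::real_vector \<Rightarrow> 'a \<Rightarrow> 'a) \<Rightarrow> 'a set" where
  "lie_derived br = bracket_space br UNIV UNIV"

definition lie_center :: "('a::real_vector \<Rightarrow> 'a \<Rightarrow> 'a) \<Rightarrow> 'a set" where
  "lie_center br = {Z. \<forall>X. br Z X = 0}"

definition two_step_nilpotent :: "('a::real_vector \<Rightarrow> 'a \<Rightarrow> 'a) \<Rightarrow> bool" where
  "two_step_nilpotent br \<longleftrightarrow> lie_derived br \<noteq> {0} \<and> lie_derived br \<subseteq> lie_center br"

definition lie_ideal :: "('a::real_vector \<Rightarrow> 'a \<Rightarrow> 'a) \<Rightarrow> 'a set \<Rightarrow> bool" where
  "lie_ideal br I \<longleftrightarrow> subspace I \<and> (\<forall>X. \<forall>Y\<in>I. br X Y \<in> I)"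

text \<open>In the next definition \<open>+\<close> is the elementwise sum of sets.\<close>

definition quat_hull ::
    "('a::real_vector \<Rightarrow> 'a) \<Rightarrow> ('a \<Rightarrow> 'a) \<Rightarrow> ('a \<Rightarrow> 'a) \<Rightarrow> 'a set \<Rightarrow> 'a set" where
  "quat_hull J1 J2 J3 W = W + J1 ` W + J2 ` W + J3 ` W"

primrec H_series ::
    "('a::real_vector \<Rightarrow> 'a \<Rightarrow> 'a) \<Rightarrow> ('a \<Rightarrow> 'a) \<Rightarrow> ('a \<Rightarrow> 'a) \<Rightarrow> ('a \<Rightarrow> 'a) \<Rightarrow> nat \<Rightarrow> 'a set" where
  "H_series br J1 J2 J3 0 = UNIV"
| "H_series br J1 J2 J3 (Suc k) =
     quat_hull J1 J2 J3 (bracket_space br (H_series br J1 J2 J3 k) (H_series br J1 J2 J3 k))"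

definition H_solvable ::
    "('a::real_vector \<Rightarrow> 'a \<Rightarrow> 'a) \<Rightarrow> ('a \<Rightarrow> 'a) \<Rightarrow> ('a \<Rightarrow> 'a) \<Rightarrow> ('a \<Rightarrow> 'a) \<Rightarrow> bool" where
  "H_solvable br J1 J2 J3 \<longleftrightarrow> (\<exists>k. H_series br J1 J2 J3 k = {0})"

text \<open>Meaningful only for \<open>H_solvable\<close> algebras; otherwise \<open>LEAST\<close> is an unspecified number.\<close>

definition H_solvability_step ::
    "('a::real_vector \<Rightarrow> 'a \<Rightarrow> 'a) \<Rightarrow> ('a \<Rightarrow> 'a) \<Rightarrow> ('a \<Rightarrow> 'a) \<Rightarrow> ('a \<Rightarrow> 'a) \<Rightarrow> nat" where
  "H_solvability_step br J1 J2 J3 = (LEAST k. H_series br J1 J2 J3 k = {0})"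

end

theory Submission
  imports Defs
begin

text \<open>
  The theorem rests on one consequence of integrability. If \<open>X\<close> is central, then two of the four
  terms of the Nijenhuis tensor vanish, and what remains says that \<open>J\<^sub>\<alpha>\<close> can be pulled out of the
  bracket: \<open>[J\<^sub>\<alpha> X, J\<^sub>\<alpha> Y] = J\<^sub>\<alpha> [J\<^sub>\<alpha> X, Y]\<close> for every \<open>Y\<close>.

  Write \<open>C\<close> for the center and let \<open>X, Y \<in> C\<close>. Taking \<open>J\<^sub>\<alpha> X\<close> and \<open>J\<^sub>\<alpha> Y\<close> gives
  \<open>[J\<^sub>\<alpha> C, J\<^sub>\<alpha> C] = 0\<close>. Put \<open>a = [J\<^sub>1 X, J\<^sub>2 Y]\<close>. Since \<open>J\<^sub>1 J\<^sub>2 = J\<^sub>3\<close> and \<open>J\<^sub>2 J\<^sub>3 = J\<^sub>1\<close>, the same rule yields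
  \<open>[J\<^sub>1 X, J\<^sub>3 Y] = J\<^sub>1 a\<close> and \<open>[J\<^sub>2 Y, J\<^sub>3 X] = J\<^sub>2 a\<close>. Hence \<open>a\<close>, \<open>J\<^sub>1 a\<close> and \<open>J\<^sub>2 a\<close> are all brackets, and
  so they are central when the algebra is 2-step nilpotent. Only \<open>J\<^sub>3 a\<close> may fail to be central.

  The first term of the series, the quaternionic span of the derived algebra, lies in that of \<open>C\<close>,
  so its brackets are sums of brackets of this kind, and the second term lies in \<open>C + J\<^sub>3 C\<close>. This
  space is abelian because \<open>[J\<^sub>3 C, J\<^sub>3 C] = 0\<close>; therefore the third term is zero.

  Properness is then formal: if the first term were the whole algebra, every term would be, and the
  algebra would be zero, against the assumption that its derived algebra is nonzero. Finally,
  the first term is an ideal because it is a subspace containing the derived algebra.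
\<close>

section \<open>Quaternionic spans\<close>

lemma quat_hull_eq:
  "quat_hull J1 J2 J3 W =
    {x + J1 y + J2 z + J3 w | x y z w. x \<in> W \<and> y \<in> W \<and> z \<in> W \<and> w \<in> W}"
  unfolding quat_hull_def set_plus_def by blast

lemma subspace_set_plus:
  fixes S T :: "'a::real_vector set"
  assumes "subspace S" "subspace T"
  shows "subspace (S + T)"
proof -
  have "S + T = {x + y | x y. x \<in> S \<and> y \<in> T}"
    by (auto simp: set_plus_def)
  then show ?thesis
    using subspace_sums[OF assms] by simp
qed

context hypercomplex_lie_algebra
begin

lemma subspace_quat_hull:
  assumes "subspace W"
  shows "subspace (quat_hull J1 J2 J3 W)"
  unfolding quat_hull_def
  by (intro subspace_set_plus linear_subspace_image assms J_linear)

lemma quat_hull_superset: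
  assumes "subspace W"
  shows "W \<subseteq> quat_hull J1 J2 J3 W"
proof
  fix x assume "x \<in> W"
  moreover have "0 \<in> W" using assms by (rule subspace_0)
  moreover have "x = x + J1 0 + J2 0 + J3 0"
    using J_linear by (simp add: linear_0)
  ultimately show "x \<in> quat_hull J1 J2 J3 W"
    unfolding quat_hull_eq by blast
qed

lemma quat_hull_zero: "quat_hull J1 J2 J3 {0} = {0}"
  unfolding quat_hull_eq using J_linear by (simp add: linear_0)

lemma J_neg: "J1 (- X) = - J1 X" "J2 (- X) = - J2 X" "J3 (- X) = - J3 X"
  using J_linear by (simp_all add: linear_neg)

lemma quaternion_relations:
  "J2 (J1 X) = - J3 X" "J1 (J3 X) = - J2 X" "J3 (J1 X) = J2 X" "J2 (J3 X) = J1 X" "J3 (J2 X) = - J1 X"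
proof -
  show J21: "J2 (J1 X) = - J3 X" for X using J2_J1[of X] by (metis minus_minus)
  show "J1 (J3 X) = - J2 X"
    using J_square(1)[of "J2 X"] by (simp add: J1_J2)
  show "J3 (J1 X) = J2 X"
    using J2_J1[of "J1 X"] by (simp add: J_square J_neg)
  show "J2 (J3 X) = J1 X"
    using J_square(2)[of "J1 X"] by (simp add: J21 J_neg)
  show "J3 (J2 X) = - J1 X"
    using J1_J2[of "J2 X"] by (simp add: J_square J_neg)
qed

text \<open>For a subspace \<open>T\<close> this is its largest quaternionic subspace, because the four conditions say
  that the quaternionic span of \<open>v\<close> lies in \<open>T\<close>.\<close>

definition quat_core :: "'a set \<Rightarrow> 'a set" where
  "quat_core T = {v. v \<in> T \<and> J1 v \<in> T \<and> J2 v \<in> T \<and> J3 v \<in> T}"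

lemma subspace_quat_core:
  assumes "subspace T"
  shows "subspace (quat_core T)"
proof -
  note T = subspace_0[OF assms] subspace_add[OF assms] subspace_scale[OF assms]
  show ?thesis
    using J_linear
    by (intro subspaceI) (auto simp: quat_core_def linear_0 linear_add linear_scale intro: T)
qed

lemma J_in_quat_core:
  assumes "subspace T" "v \<in> quat_core T"
  shows "J1 v \<in> quat_core T" "J2 v \<in> quat_core T"
  using assms subspace_neg[OF assms(1)]
  by (auto simp: quat_core_def J_square J1_J2 quaternion_relations)

lemma quat_hull_subset_of_core:
  assumes "subspace T" "W \<subseteq> quat_core T"
  shows "quat_hull J1 J2 J3 W \<subseteq> T"
proof
  fix v assume "v \<in> quat_hull J1 J2 J3 W"
  then obtain x y z w where v: "v = x + J1 y + J2 z + J3 w"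
    and "x \<in> W" "y \<in> W" "z \<in> W" "w \<in> W"
    unfolding quat_hull_eq by blast
  then have "x \<in> T" "J1 y \<in> T" "J2 z \<in> T" "J3 w \<in> T"
    using assms(2) unfolding quat_core_def by blast+
  then show "v \<in> T"
    unfolding v by (intro subspace_add[OF assms(1)])
qed


section \<open>Brackets of quaternionic multiples of central elements\<close>

lemmas br_simps =
  bilinear_ladd[OF br_bilinear] bilinear_radd[OF br_bilinear]
  bilinear_lneg[OF br_bilinear] bilinear_rneg[OF br_bilinear]
  bilinear_lzero[OF br_bilinear] bilinear_rzero[OF br_bilinear]

lemma br_skew: "br X Y = - br Y X"
proof -
  have "br (X + Y) (X + Y) = (br X X + br Y X) + (br X Y + br Y Y)"
    by (simp only: br_simps)
  then have "br Y X + br X Y = 0"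
    by (simp only: br_alternating add_0 add_0_right)
  then show ?thesis by (simp add: eq_neg_iff_add_eq_0 add.commute)
qed

lemma br_center: "X \<in> lie_center br \<Longrightarrow> br X Y = 0" "X \<in> lie_center br \<Longrightarrow> br Y X = 0"
  using br_skew[of Y X] by (auto simp: lie_center_def)

lemma subspace_center: "subspace (lie_center br)"
  using br_bilinear
  by (intro subspaceI)
    (auto simp: lie_center_def br_simps bilinear_lmul)

lemma br_in_derived: "br X Y \<in> lie_derived br"
  unfolding lie_derived_def bracket_space_def by (rule span_base) blast

text \<open>Of the Nijenhuis tensor evaluated at a central \<open>X\<close> only \<open>J [J X, Y] - [J X, J Y]\<close> survives.\<close>

lemma br_J_center:
  assumes "X \<in> lie_center br"
  shows "br (J1 X) (J1 Y) = J1 (br (J1 X) Y)"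
    and "br (J2 X) (J2 Y) = J2 (br (J2 X) Y)"
    and "br (J3 X) (J3 Y) = J3 (br (J3 X) Y)"
  using J_integrable[of X Y] by (simp_all add: nijenhuis_def br_center(1)[OF assms])

lemma br_same_J_center:
  assumes "X \<in> lie_center br" "Y \<in> lie_center br"
  shows "br (J1 X) (J1 Y) = 0" "br (J2 X) (J2 Y) = 0" "br (J3 X) (J3 Y) = 0"
  using J_linear by (simp_all add: br_J_center assms br_center linear_0)

text \<open>Substitute \<open>J\<^sub>3 = J\<^sub>1 J\<^sub>2\<close> in the first equation and \<open>J\<^sub>1 = J\<^sub>2 J\<^sub>3\<close> in the bracket on the right of
  the second one.\<close>

lemma mixed_brackets:
  assumes "X \<in> lie_center br" "Y \<in> lie_center br"
  shows "br (J1 X) (J3 Y) = J1 (br (J1 X) (J2 Y))"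
    and "br (J2 Y) (J3 X) = J2 (br (J1 X) (J2 Y))"
proof -
  show "br (J1 X) (J3 Y) = J1 (br (J1 X) (J2 Y))"
    using br_J_center(1)[OF assms(1), of "J2 Y"] by (simp add: J1_J2)
  have "br (J2 Y) (J1 X) = J2 (br (J2 Y) (J3 X))"
    using br_J_center(2)[OF assms(2), of "J3 X"] by (simp add: quaternion_relations)
  then have "J2 (br (J2 Y) (J1 X)) = - br (J2 Y) (J3 X)"
    by (simp add: J_square)
  then show "br (J2 Y) (J3 X) = J2 (br (J1 X) (J2 Y))"
    using br_skew[of "J2 Y" "J1 X"] by (simp add: J_neg)
qed


section \<open>The series of a 2-step nilpotent algebra\<close>

abbreviation center_plus_J3 :: "'a set" where
  "center_plus_J3 \<equiv> lie_center br + J3 ` lie_center br"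

lemma subspace_center_plus_J3: "subspace center_plus_J3"
  by (intro subspace_set_plus linear_subspace_image subspace_center J_linear)

lemma center_plus_J3_abelian:
  assumes "X \<in> center_plus_J3" "Y \<in> center_plus_J3"
  shows "br X Y = 0"
  using assms by (auto simp: set_plus_def br_simps br_center br_same_J_center)

text \<open>For \<open>a = [J\<^sub>1 X, J\<^sub>2 Y]\<close> the vectors \<open>a\<close>, \<open>J\<^sub>1 a\<close>, \<open>J\<^sub>2 a\<close> are brackets, hence central, and
  \<open>J\<^sub>3 a\<close> lies in \<open>J\<^sub>3 C\<close>.\<close>

lemma br_J1_J2_in_core:
  assumes "lie_derived br \<subseteq> lie_center br" "X \<in> lie_center br" "Y \<in> lie_center br"
  shows "br (J1 X) (J2 Y) \<in> quat_core center_plus_J3"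
proof -
  let ?a = "br (J1 X) (J2 Y)"
  have bracket_central: "br U V \<in> lie_center br" for U V
    using br_in_derived assms(1) by blast
  have zero: "0 \<in> lie_center br" using subspace_center by (rule subspace_0)
  have central: "c \<in> center_plus_J3" if "c \<in> lie_center br" for c
    using set_plus_intro[OF that imageI[OF zero, of J3]] J_linear by (simp add: linear_0)
  have "J1 ?a \<in> lie_center br" "J2 ?a \<in> lie_center br"
    unfolding mixed_brackets[OF assms(2,3), symmetric] by (rule bracket_central)+
  moreover have "J3 ?a \<in> center_plus_J3"
    using set_plus_intro[OF zero imageI[OF bracket_central, of J3]] by simp
  ultimately show ?thesis
    using central bracket_central unfolding quat_core_def by blast
qed

text \<open>Each term of the series is the quaternionic span of brackets. The brackets are therefore
  placed in the core, whose quaternionic span stays inside \<open>C + J\<^sub>3 C\<close>. Since the core is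
  quaternionic, the case \<open>[J\<^sub>1 X, J\<^sub>2 Y]\<close> settles all other mixed brackets.\<close>

lemma br_quat_hull_center_in_core:
  assumes derived: "lie_derived br \<subseteq> lie_center br"
    and "X \<in> quat_hull J1 J2 J3 (lie_center br)" "Y \<in> quat_hull J1 J2 J3 (lie_center br)"
  shows "br X Y \<in> quat_core center_plus_J3"
proof -
  let ?U = "quat_core center_plus_J3"
  note T = subspace_center_plus_J3
  note U = subspace_quat_core[OF T]
  have J12: "br (J1 x) (J2 y) \<in> ?U" and J13: "br (J1 x) (J3 y) \<in> ?U"
    and J23: "br (J2 x) (J3 y) \<in> ?U"
    if "x \<in> lie_center br" "y \<in> lie_center br" for x y
    using that br_J1_J2_in_core[OF derived] J_in_quat_core[OF T] by (simp_all add: mixed_brackets)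
  have J21: "br (J2 x) (J1 y) \<in> ?U" and J31: "br (J3 x) (J1 y) \<in> ?U"
    and J32: "br (J3 x) (J2 y) \<in> ?U"
    if "x \<in> lie_center br" "y \<in> lie_center br" for x y
    using subspace_neg[OF U] J12 J13 J23 that br_skew by metis+
  from assms obtain x0 x1 x2 x3 y0 y1 y2 y3
    where X: "X = x0 + J1 x1 + J2 x2 + J3 x3" and Y: "Y = y0 + J1 y1 + J2 y2 + J3 y3"
      and x: "x0 \<in> lie_center br" "x1 \<in> lie_center br" "x2 \<in> lie_center br" "x3 \<in> lie_center br"
      and y: "y0 \<in> lie_center br" "y1 \<in> lie_center br" "y2 \<in> lie_center br" "y3 \<in> lie_center br"
    unfolding quat_hull_eq by blast
  have "br X Y = br (J1 x1) (J2 y2) + br (J1 x1) (J3 y3) + br (J2 x2) (J1 y1)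
      + br (J2 x2) (J3 y3) + br (J3 x3) (J1 y1) + br (J3 x3) (J2 y2)"
    unfolding X Y by (simp add: br_simps br_center x y br_same_J_center)
  then show ?thesis
    using x y by (auto intro!: subspace_add[OF U] J12 J13 J23 J21 J31 J32)
qed

lemma subspace_H_series: "subspace (H_series br J1 J2 J3 k)"
  by (cases k) (simp_all add: subspace_quat_hull bracket_space_def)

lemma H_series_1: "H_series br J1 J2 J3 1 = quat_hull J1 J2 J3 (lie_derived br)"
  by (simp add: lie_derived_def)

lemma H_series_2_subset:
  assumes "lie_derived br \<subseteq> lie_center br"
  shows "H_series br J1 J2 J3 2 \<subseteq> center_plus_J3"
proof -
  have first: "H_series br J1 J2 J3 1 \<subseteq> quat_hull J1 J2 J3 (lie_center br)"
    unfolding H_series_1 using assms by (auto simp: quat_hull_eq) blast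
  have "bracket_space br (H_series br J1 J2 J3 1) (H_series br J1 J2 J3 1)
      \<subseteq> quat_core center_plus_J3"
    unfolding bracket_space_def using first br_quat_hull_center_in_core[OF assms]
    by (intro span_minimal subspace_quat_core subspace_center_plus_J3) blast
  then show ?thesis
    using quat_hull_subset_of_core[OF subspace_center_plus_J3]
    by (simp add: numeral_2_eq_2)
qed

lemma H_series_3_eq_zero:
  assumes "lie_derived br \<subseteq> lie_center br"
  shows "H_series br J1 J2 J3 3 = {0}"
proof -
  let ?S = "H_series br J1 J2 J3 2"
  have "{br X Y | X Y. X \<in> ?S \<and> Y \<in> ?S} \<subseteq> {0}"
    using H_series_2_subset[OF assms] center_plus_J3_abelian by blast
  then have "bracket_space br ?S ?S \<subseteq> {0}"
    unfolding bracket_space_def by (intro span_minimal) simp_all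
  moreover have "0 \<in> bracket_space br ?S ?S"
    unfolding bracket_space_def by (rule span_zero)
  ultimately have "bracket_space br ?S ?S = {0}" by blast
  then show ?thesis
    using quat_hull_zero by (simp add: numeral_3_eq_3 numeral_2_eq_2)
qed

lemma H_series_1_ideal: "lie_ideal br (H_series br J1 J2 J3 1)"
proof -
  have "lie_derived br \<subseteq> H_series br J1 J2 J3 1"
    unfolding H_series_1 by (intro quat_hull_superset) (simp add: lie_derived_def bracket_space_def)
  then show ?thesis
    unfolding lie_ideal_def using subspace_H_series br_in_derived by blast
qed

lemma H_series_UNIV:
  assumes "H_series br J1 J2 J3 1 = UNIV"
  shows "H_series br J1 J2 J3 k = UNIV"
  using assms by (induction k) simp_all

lemma H_series_1_proper:
  assumes "two_step_nilpotent br"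
  shows "H_series br J1 J2 J3 1 \<noteq> UNIV"
proof
  assume "H_series br J1 J2 J3 1 = UNIV"
  then have "UNIV = {0::'a}"
    using H_series_UNIV H_series_3_eq_zero assms unfolding two_step_nilpotent_def by metis
  moreover have "0 \<in> lie_derived br"
    unfolding lie_derived_def bracket_space_def by (rule span_zero)
  ultimately have "lie_derived br = {0}" by blast
  then show False using assms unfolding two_step_nilpotent_def by blast
qed

end

theorem theorem5p4:
  fixes br :: "'a::real_vector \<Rightarrow> 'a \<Rightarrow> 'a" and J1 J2 J3 :: "'a \<Rightarrow> 'a"
  assumes "hypercomplex_lie_algebra br J1 J2 J3"
    and "two_step_nilpotent br"
  shows "H_solvable br J1 J2 J3
    \<and> H_series br J1 J2 J3 1 =
        lie_derived br + J1 ` lie_derived br + J2 ` lie_derived br + J3 ` lie_derived br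
    \<and> lie_ideal br (H_series br J1 J2 J3 1)
    \<and> H_series br J1 J2 J3 1 \<noteq> UNIV
    \<and> H_solvability_step br J1 J2 J3 \<le> 3"
proof -
  interpret hypercomplex_lie_algebra br J1 J2 J3 by (rule assms(1))
  have three: "H_series br J1 J2 J3 3 = {0}"
    using H_series_3_eq_zero assms(2) unfolding two_step_nilpotent_def by blast
  then have "H_solvable br J1 J2 J3"
    unfolding H_solvable_def by blast
  moreover have "H_solvability_step br J1 J2 J3 \<le> 3"
    unfolding H_solvability_step_def using three by (rule Least_le)
  ultimately show ?thesis
    using H_series_1 H_series_1_ideal H_series_1_proper[OF assms(2)]
    unfolding quat_hull_def by blast
qed

end
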